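(* Let $n\geqslant 2$ be an integer. Then for every $c\in[0,1]$, $$f_n(c)\leqslant\sqrt{\frac{n-4(n-1)\sin^2(\pi/(2n))\,(1-c)}{n+4(n-1)^2\sin^2(\pi/(2n))\,(1-c)}}.$$
   Context: For closed subspaces $H_1,\dots,H_n$ ($n\geqslant 2$) of a complex Hilbert space $H$, put $H_0:=H_1\cap\dots\cap H_n$ and let $P_k$ be the orthogonal projection of $H$ onto $H_k$, $k=0,1,\dots,n$. The Friedrichs number is $$c_F(H_1,\dots,H_n):=\sup\left\{\frac{2}{n-1}\frac{\sum_{i<j}\mathrm{Re}\langle x_i,x_j\rangle}{\|x_1\|^2+\dots+\|x_n\|^2}\,:\, x_i\in H_i\ominus H_0,\ i=1,\dots,n,\ (x_1,\dots,x_n)\neq(0,\dots,0)\right\},$$ where $H_i\ominus H_0$ is the orthogonal complement of $H_0$ in $H_i$ (if all $H_i=H_0$, the supremum is over the empty set and is taken to be $0$). For $c\in[0,1]$, $$f_n(c):=\sup\{\|P_n\cdots P_2P_1-P_0\|\,:\, c_F(H_1,\dots,H_n)\leqslant c\},$$ the supremum being over all complex Hilbert spaces $H$ and all systems of closed subspaces $H_1,\dots,H_n$ of $H$ with $c_F(H_1,\dots,H_n)\leqslant c$. *)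

theory Defs
  imports "HOL-Analysis.Analysis"
begin

text \<open>
  Complex Hilbert spaces as a type class. The inner product is linear in its first and
  conjugate-linear in its second argument.
\<close>

class complex_inner = real_normed_vector +
  fixes scaleC :: "complex \<Rightarrow> 'a \<Rightarrow> 'a"  (infixr "*\<^sub>C" 75)
    and cinner :: "'a \<Rightarrow> 'a \<Rightarrow> complex"
  assumes scaleC_add_right: "a *\<^sub>C (x + y) = a *\<^sub>C x + a *\<^sub>C y"
    and scaleC_add_left: "(a + b) *\<^sub>C x = a *\<^sub>C x + b *\<^sub>C x"
    and scaleC_scaleC: "a *\<^sub>C b *\<^sub>C x = (a * b) *\<^sub>C x"
    and scaleC_of_real: "complex_of_real r *\<^sub>C x = r *\<^sub>R x"
    and cinner_commute: "cinner x y = cnj (cinner y x)"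
    and cinner_add_left: "cinner (x + y) z = cinner x z + cinner y z"
    and cinner_scaleC_left: "cinner (a *\<^sub>C x) y = a * cinner x y"
    and cinner_pos: "x \<noteq> 0 \<Longrightarrow> 0 < Re (cinner x x)"
    and norm_eq_sqrt_cinner: "norm x = sqrt (Re (cinner x x))"

class chilbert_space = complex_inner + complete_space

instantiation complex :: chilbert_space
begin

definition scaleC_complex :: "complex \<Rightarrow> complex \<Rightarrow> complex" where
  "scaleC_complex a x = a * x"

definition cinner_complex :: "complex \<Rightarrow> complex \<Rightarrow> complex" where
  "cinner_complex x y = x * cnj y"

instance
proof
  fix x :: complex
  show "0 < Re (cinner x x)" if "x \<noteq> 0"
    using that by (simp add: cinner_complex_def complex_neq_0 flip: power2_eq_square)
  show "norm x = sqrt (Re (cinner x x))"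
    by (simp add: cinner_complex_def cmod_def power2_eq_square)
qed (simp_all add: scaleC_complex_def cinner_complex_def algebra_simps scaleR_conv_of_real)

end

definition closed_csubspace :: "'h::complex_inner set \<Rightarrow> bool" where
  "closed_csubspace M \<longleftrightarrow> closed M \<and> subspace M \<and> (\<forall>a. \<forall>x\<in>M. a *\<^sub>C x \<in> M)"

definition orth_diff :: "'h::complex_inner set \<Rightarrow> 'h set \<Rightarrow> 'h set"  (infixl "\<ominus>" 65) where
  "M \<ominus> N = {x \<in> M. \<forall>y\<in>N. cinner x y = 0}"

text \<open>
  Orthogonal projection onto \<open>M\<close>; the described point exists and is unique if \<open>M\<close> is a closed
  subspace of a Hilbert space.
\<close>

definition proj :: "'h::complex_inner set \<Rightarrow> 'h \<Rightarrow> 'h" where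
  "proj M x = (THE y. y \<in> M \<and> (\<forall>z\<in>M. cinner (x - y) z = 0))"

text \<open>
  A system \<open>H\<^sub>1, \<dots>, H\<^sub>n\<close> is a function on \<open>nat\<close> of which only the values at \<open>1, \<dots>, n\<close> are used.
\<close>

definition common_part :: "nat \<Rightarrow> (nat \<Rightarrow> 'h set) \<Rightarrow> 'h set" where
  "common_part n H = (\<Inter>i\<in>{1..n}. H i)"

primrec proj_prod :: "(nat \<Rightarrow> 'h::complex_inner set) \<Rightarrow> nat \<Rightarrow> 'h \<Rightarrow> 'h" where
  "proj_prod H 0 = id"
| "proj_prod H (Suc k) = proj (H (Suc k)) \<circ> proj_prod H k"

definition friedrichs_quotients :: "nat \<Rightarrow> (nat \<Rightarrow> 'h::complex_inner set) \<Rightarrow> real set" where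
  "friedrichs_quotients n H =
     {2 / (real n - 1) *
        ((\<Sum>j=1..n. \<Sum>i=1..<j. Re (cinner (x i) (x j))) / (\<Sum>i=1..n. (norm (x i))\<^sup>2)) | x.
      (\<forall>i\<in>{1..n}. x i \<in> H i \<ominus> common_part n H) \<and> (\<exists>i\<in>{1..n}. x i \<noteq> 0)}"

text \<open>
  For \<open>n \<ge> 2\<close> the quotients are bounded above by \<open>1\<close>, so that \<open>Sup\<close> is a genuine supremum
  whenever there is a quotient at all.
\<close>

definition friedrichs_number :: "nat \<Rightarrow> (nat \<Rightarrow> 'h::complex_inner set) \<Rightarrow> real" where
  "friedrichs_number n H =
     (if friedrichs_quotients n H = {} then 0 else Sup (friedrichs_quotients n H))"

text \<open>
  A term cannot quantify over types, so the ambient Hilbert space is the type argument \<open>'h\<close>.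
  A bound by a fixed number for the supremum over all Hilbert spaces is the same bound for
  \<open>sup_proj_norm TYPE('h)\<close> for every \<open>'h\<close>. For \<open>n \<ge> 2\<close> and \<open>c \<ge> 0\<close> the set below is non-empty
  (all \<open>H i\<close> equal) and bounded above by \<open>1\<close>.
\<close>

definition sup_proj_norm :: "'h::chilbert_space itself \<Rightarrow> nat \<Rightarrow> real \<Rightarrow> real" where
  "sup_proj_norm _ n c =
     Sup {onorm (\<lambda>x. proj_prod H n x - proj (common_part n H) x) | H :: nat \<Rightarrow> 'h set.
            (\<forall>i\<in>{1..n}. closed_csubspace (H i)) \<and> friedrichs_number n H \<le> c}"

end

theory Submission
  imports Defs
begin

text \<open>
  Subtracting the projection onto \<open>H\<^sub>0\<close> reduces the claim to a starting vector \<open>z \<perp> H\<^sub>0\<close>. Put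
  \<open>x\<^sub>0 = z\<close> and \<open>x\<^sub>k = P\<^sub>k x\<^sub>k\<^sub>-\<^sub>1\<close>; every \<open>x\<^sub>k\<close> with \<open>k \<ge> 1\<close> lies in \<open>H\<^sub>k \<ominus> H\<^sub>0\<close>, so the vectors
  \<open>x\<^sub>1, \<dots>, x\<^sub>n\<close> are themselves an admissible system for the Friedrichs number. Three facts
  about them combine, where \<open>m\<close> is their mean and \<open>\<mu> = 4 sin\<^sup>2(\<pi>/(2n))\<close>.

  \<^item> By Pythagoras, \<open>\<parallel>x\<^sub>k\<^sub>+\<^sub>1 - x\<^sub>k\<parallel>\<^sup>2 = \<parallel>x\<^sub>k\<parallel>\<^sup>2 - \<parallel>x\<^sub>k\<^sub>+\<^sub>1\<parallel>\<^sup>2\<close>, so the energy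
    \<open>\<Sum>\<^sub>1\<^sub>\<le>\<^sub>k\<^sub><\<^sub>n \<parallel>x\<^sub>k\<^sub>+\<^sub>1 - x\<^sub>k\<parallel>\<^sup>2\<close> of the trajectory telescopes to \<open>\<parallel>x\<^sub>1\<parallel>\<^sup>2 - \<parallel>x\<^sub>n\<parallel>\<^sup>2\<close>.
  \<^item> A trajectory of low energy cannot spread far: the energy is at least
    \<open>\<mu> \<Sum> \<parallel>x\<^sub>i - m\<parallel>\<^sup>2\<close>, since \<open>\<mu>\<close> is the spectral gap of the path on \<open>n\<close> vertices
    (\<open>discrete_wirtinger\<close>).
  \<^item> Vectors from the different \<open>H\<^sub>i \<ominus> H\<^sub>0\<close> cannot be close together: a Friedrichs number of at
    most \<open>c\<close> gives \<open>n \<Sum> \<parallel>x\<^sub>i - m\<parallel>\<^sup>2 \<ge> (n - 1) (1 - c) \<Sum> \<parallel>x\<^sub>i\<parallel>\<^sup>2\<close>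
    (\<open>friedrichs_inequality\<close> and \<open>variance_identity\<close>).

  As the norms decrease, \<open>\<Sum> \<parallel>x\<^sub>i\<parallel>\<^sup>2 \<ge> \<parallel>x\<^sub>1\<parallel>\<^sup>2 + (n - 1) \<parallel>x\<^sub>n\<parallel>\<^sup>2\<close>. With
  \<open>g = \<mu> (n - 1) (1 - c)\<close> the three facts therefore yield
  \<open>n (\<parallel>x\<^sub>1\<parallel>\<^sup>2 - \<parallel>x\<^sub>n\<parallel>\<^sup>2) \<ge> g (\<parallel>x\<^sub>1\<parallel>\<^sup>2 + (n - 1) \<parallel>x\<^sub>n\<parallel>\<^sup>2)\<close>. Solving for \<open>\<parallel>x\<^sub>n\<parallel>\<^sup>2\<close> gives the
  bound, because \<open>\<parallel>x\<^sub>1\<parallel> \<le> \<parallel>z\<parallel>\<close> and \<open>g \<le> n\<close>.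
\<close>

section \<open>The real inner product of a complex Hilbert space\<close>

definition rinner :: "'h::complex_inner \<Rightarrow> 'h \<Rightarrow> real" where
  "rinner x y = Re (cinner x y)"

lemma rinner_add_left: "rinner (x + y) z = rinner x z + rinner y z"
  by (simp add: rinner_def cinner_add_left)

lemma rinner_commute: "rinner x y = rinner y x"
  unfolding rinner_def by (subst cinner_commute) simp

lemma rinner_scaleR_left: "rinner (r *\<^sub>R x) y = r * rinner x y"
  by (simp add: rinner_def cinner_scaleC_left flip: scaleC_of_real)

lemma rinner_add_right: "rinner x (y + z) = rinner x y + rinner x z"
  by (metis rinner_add_left rinner_commute)

lemma rinner_scaleR_right: "rinner x (r *\<^sub>R y) = r * rinner x y"
  by (metis rinner_scaleR_left rinner_commute)

lemma rinner_minus_left: "rinner (- x) y = - rinner x y"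
  using rinner_scaleR_left[of "-1" x y] by simp

lemma rinner_minus_right: "rinner x (- y) = - rinner x y"
  using rinner_scaleR_right[of x "-1" y] by simp

lemma rinner_diff_left: "rinner (x - y) z = rinner x z - rinner y z"
  using rinner_add_left[of x "- y" z] by (simp add: rinner_minus_left)

lemma rinner_diff_right: "rinner x (y - z) = rinner x y - rinner x z"
  by (metis rinner_diff_left rinner_commute)

lemma rinner_zero_left [simp]: "rinner 0 y = 0"
  using rinner_scaleR_left[of 0 0 y] by simp

lemma rinner_zero_right [simp]: "rinner y 0 = 0"
  by (metis rinner_zero_left rinner_commute)

lemma rinner_sum_left: "rinner (\<Sum>i\<in>A. f i) y = (\<Sum>i\<in>A. rinner (f i) y)"
  by (induction A rule: infinite_finite_induct) (auto simp: rinner_add_left)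

lemma rinner_self: "rinner x x = (norm x)\<^sup>2"
proof -
  have "0 \<le> Re (cinner x x)"
  proof (cases "x = 0")
    case True
    have "cinner (0 *\<^sub>C x) x = 0" by (simp add: cinner_scaleC_left)
    moreover have "0 *\<^sub>C x = 0" using scaleC_of_real[of 0 x] by simp
    ultimately show ?thesis using True by simp
  next
    case False then show ?thesis using cinner_pos[of x] by simp
  qed
  then show ?thesis by (simp add: rinner_def norm_eq_sqrt_cinner)
qed

lemmas rinner_bilinear =
  rinner_add_left rinner_add_right rinner_diff_left rinner_diff_right
  rinner_scaleR_left rinner_scaleR_right

lemma norm_sq_add: "(norm (x + y))\<^sup>2 = (norm x)\<^sup>2 + 2 * rinner x y + (norm y)\<^sup>2"
  unfolding rinner_self[symmetric] by (simp add: rinner_bilinear rinner_commute)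

lemma norm_sq_diff: "(norm (x - y))\<^sup>2 = (norm x)\<^sup>2 - 2 * rinner x y + (norm y)\<^sup>2"
  unfolding rinner_self[symmetric] by (simp add: rinner_bilinear rinner_commute)

text \<open>
  Young's inequality. In \<open>dirichlet_inequality\<close> the weight \<open>t\<close> is a quotient of consecutive
  values of the ground state.
\<close>
lemma two_rinner_le:
  assumes "t > 0"
  shows "2 * rinner x y \<le> t * (norm x)\<^sup>2 + (norm y)\<^sup>2 / t"
proof -
  have "0 \<le> (norm (t *\<^sub>R x - y))\<^sup>2" by simp
  also have "\<dots> = t\<^sup>2 * (norm x)\<^sup>2 - 2 * (t * rinner x y) + (norm y)\<^sup>2"
    by (simp add: norm_sq_diff power_mult_distrib rinner_scaleR_left)
  also have "\<dots> = t * (t * (norm x)\<^sup>2 + (norm y)\<^sup>2 / t - 2 * rinner x y)"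
    using assms by (simp add: field_simps power2_eq_square)
  finally show ?thesis using assms by (simp add: zero_le_mult_iff)
qed

text \<open>
  On a set closed under multiplication by \<open>\<i>\<close>, real orthogonality already controls the
  imaginary part of the inner product, so all orthogonality arguments may use \<open>rinner\<close>.
\<close>
lemma rinner_zero_imp_cinner_zero:
  assumes "\<And>z. z \<in> M \<Longrightarrow> rinner x z = 0" "\<And>z. z \<in> M \<Longrightarrow> \<i> *\<^sub>C z \<in> M" "z \<in> M"
  shows "cinner x z = 0"
proof -
  have "rinner x (\<i> *\<^sub>C z) = Re (\<i> * cinner z x)"
    by (metis rinner_commute rinner_def cinner_scaleC_left)
  then have "Im (cinner z x) = 0" using assms by simp
  moreover have "Re (cinner z x) = 0"
    using assms(1)[OF assms(3)] rinner_commute rinner_def by metis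
  ultimately have "cinner z x = 0" by (simp add: complex_eq_iff)
  then show ?thesis using cinner_commute[of x z] by simp
qed

section \<open>Orthogonal projections\<close>

text \<open>
  A minimizing sequence is Cauchy: by the parallelogram law, two almost-minimizers must be close
  to each other, since their midpoint is no closer to \<open>x\<close> than the infimum.
\<close>
lemma closed_subspace_minimizer_exists:
  fixes x :: "'h::chilbert_space"
  assumes "closed M" "subspace M"
  shows "\<exists>y\<in>M. \<forall>z\<in>M. norm (x - y) \<le> norm (x - z)"
proof -
  define d where "d = (INF z\<in>M. (norm (x - z))\<^sup>2)"
  have bdd: "bdd_below ((\<lambda>z. (norm (x - z))\<^sup>2) ` M)"
    by (rule bdd_belowI[of _ 0]) auto
  have d_le: "d \<le> (norm (x - z))\<^sup>2" if "z \<in> M" for z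
    unfolding d_def using bdd that by (rule cINF_lower)
  have ne: "M \<noteq> {}" using subspace_0[OF assms(2)] by auto
  have "\<exists>z\<in>M. (norm (x - z))\<^sup>2 < d + 1 / real (Suc k)" for k
    using cINF_less_iff[OF ne bdd, of "d + 1 / real (Suc k)"] unfolding d_def by simp
  then obtain y where y: "\<And>k. y k \<in> M" "\<And>k. (norm (x - y k))\<^sup>2 < d + 1 / real (Suc k)"
    by metis
  have par: "(norm (a - b))\<^sup>2 \<le> 2 * (norm (x - a))\<^sup>2 + 2 * (norm (x - b))\<^sup>2 - 4 * d"
    if "a \<in> M" "b \<in> M" for a b
  proof -
    have "(1/2) *\<^sub>R (a + b) \<in> M"
      using that assms(2) by (simp add: subspace_add subspace_scale)
    then have "d \<le> (norm (x - (1/2) *\<^sub>R (a + b)))\<^sup>2" by (rule d_le)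
    also have "x - (1/2) *\<^sub>R (a + b) = (1/2) *\<^sub>R ((x - a) + (x - b))"
      by (simp add: algebra_simps flip: scaleR_add_left)
    finally have "4 * d \<le> (norm ((x - a) + (x - b)))\<^sup>2"
      by (simp add: power_mult_distrib power2_eq_square)
    moreover have "(norm (a - b))\<^sup>2 = (norm ((x - b) - (x - a)))\<^sup>2" by simp
    ultimately show ?thesis
      unfolding norm_sq_add norm_sq_diff[of "x - b"] by (simp add: rinner_commute)
  qed
  have "Cauchy y"
  proof (rule metric_CauchyI)
    fix e :: real assume "e > 0"
    then obtain N where N: "4 / e\<^sup>2 < real (Suc N)"
      by (metis lessI of_nat_less_iff order_less_trans reals_Archimedean2)
    show "\<exists>N. \<forall>m\<ge>N. \<forall>n\<ge>N. dist (y m) (y n) < e"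
    proof (intro exI allI impI)
      fix m n assume mn: "N \<le> m" "N \<le> n"
      have "(norm (y m - y n))\<^sup>2 < 2 / real (Suc m) + 2 / real (Suc n)"
        using par[OF y(1)[of m] y(1)[of n]] y(2)[of m] y(2)[of n] by linarith
      also have "\<dots> \<le> 2 / real (Suc N) + 2 / real (Suc N)"
        using mn by (intro add_mono divide_left_mono) auto
      also have "\<dots> = 4 / real (Suc N)" by simp
      also have "\<dots> < e\<^sup>2"
        using N \<open>e > 0\<close> by (simp only: pos_divide_less_eq of_nat_0_less_iff zero_less_Suc
            zero_less_power mult.commute)
      finally show "dist (y m) (y n) < e"
        using \<open>e > 0\<close> by (simp add: dist_norm power_less_imp_less_base)
    qed
  qed
  then obtain l where l: "y \<longlonglongrightarrow> l" using Cauchy_convergent convergent_def by blast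
  have "l \<in> M" using closed_sequentially[OF assms(1) _ l] y(1) by auto
  moreover have "norm (x - l) \<le> norm (x - z)" if "z \<in> M" for z
  proof -
    have "(\<lambda>k. (norm (x - y k))\<^sup>2) \<longlonglongrightarrow> (norm (x - l))\<^sup>2"
      by (intro tendsto_intros l)
    moreover have "(\<lambda>k. d + 1 / real (Suc k)) \<longlonglongrightarrow> d + 0"
      by (intro tendsto_intros LIMSEQ_Suc[OF lim_1_over_n])
    ultimately have "(norm (x - l))\<^sup>2 \<le> d + 0"
      by (rule LIMSEQ_le) (use y(2) less_imp_le in blast)
    then have "(norm (x - l))\<^sup>2 \<le> (norm (x - z))\<^sup>2" using d_le[OF that] by linarith
    then show ?thesis by (rule power2_le_imp_le) simp
  qed
  ultimately show ?thesis by blast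
qed

text \<open>
  Moving \<open>y\<close> along \<open>z\<close> by \<open>t\<close> changes the squared distance by
  \<open>t\<^sup>2 \<parallel>z\<parallel>\<^sup>2 - 2 t rinner (x - y) z\<close>. The vertex of this parabola would lie below the minimum
  if the inner product were not zero.
\<close>
lemma minimizer_orthogonal:
  assumes "subspace M" "y \<in> M" "\<forall>z\<in>M. norm (x - y) \<le> norm (x - z)" "z \<in> M"
  shows "rinner (x - y) z = 0"
proof (cases "z = 0")
  case False
  define t where "t = rinner (x - y) z / (norm z)\<^sup>2"
  have "y + t *\<^sub>R z \<in> M" using assms by (simp add: subspace_add subspace_scale)
  then have "norm (x - y) \<le> norm ((x - y) - t *\<^sub>R z)" using assms(3) by (simp add: algebra_simps)
  then have "(norm (x - y))\<^sup>2 \<le> (norm ((x - y) - t *\<^sub>R z))\<^sup>2" by (simp add: power_mono)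
  also have "\<dots> = (norm (x - y))\<^sup>2 - 2 * t * rinner (x - y) z + t\<^sup>2 * (norm z)\<^sup>2"
    by (simp add: norm_sq_diff power_mult_distrib rinner_scaleR_right)
  also have "\<dots> = (norm (x - y))\<^sup>2 - (rinner (x - y) z)\<^sup>2 / (norm z)\<^sup>2"
    using False by (simp add: t_def field_simps power2_eq_square)
  finally have "(rinner (x - y) z)\<^sup>2 / (norm z)\<^sup>2 \<le> 0" by simp
  then show ?thesis using False by (simp add: divide_le_0_iff)
qed simp

lemma proj_eqI:
  assumes "closed_csubspace M" "y \<in> M" "\<And>z. z \<in> M \<Longrightarrow> rinner (x - y) z = 0"
  shows "proj M x = y"
proof -
  have M: "subspace M" "\<And>z. z \<in> M \<Longrightarrow> \<i> *\<^sub>C z \<in> M"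
    using assms(1) by (auto simp: closed_csubspace_def)
  show ?thesis unfolding proj_def
  proof (rule the_equality)
    show "y \<in> M \<and> (\<forall>z\<in>M. cinner (x - y) z = 0)"
      using rinner_zero_imp_cinner_zero[of M "x - y"] assms M by blast
  next
    fix v assume v: "v \<in> M \<and> (\<forall>z\<in>M. cinner (x - v) z = 0)"
    have "v - y \<in> M" using v assms(2) M(1) by (simp add: subspace_diff)
    then have "rinner (x - y) (v - y) = 0" "rinner (x - v) (v - y) = 0"
      using v assms(3) by (auto simp: rinner_def)
    then have "rinner ((x - y) - (x - v)) (v - y) = 0" by (simp add: rinner_diff_left)
    then show "v = y" by (simp add: rinner_self)
  qed
qed

lemma
  fixes x :: "'h::chilbert_space"
  assumes "closed_csubspace M"
  shows proj_in: "proj M x \<in> M"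
    and proj_orthogonal: "z \<in> M \<Longrightarrow> rinner (x - proj M x) z = 0"
proof -
  have M: "closed M" "subspace M" using assms by (auto simp: closed_csubspace_def)
  from closed_subspace_minimizer_exists[OF M, of x]
  obtain y where y: "y \<in> M" "\<forall>z\<in>M. norm (x - y) \<le> norm (x - z)" by blast
  then have "\<And>z. z \<in> M \<Longrightarrow> rinner (x - y) z = 0"
    using minimizer_orthogonal[OF M(2)] by blast
  moreover from this have "proj M x = y" using proj_eqI[OF assms y(1)] by blast
  ultimately show "proj M x \<in> M" "z \<in> M \<Longrightarrow> rinner (x - proj M x) z = 0" using y by auto
qed

text \<open>
  This form of linearity of \<open>proj M\<close> carries the component in \<open>H\<^sub>0\<close> unchanged through all the
  projections, which reduces the problem to vectors orthogonal to \<open>H\<^sub>0\<close>.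
\<close>
lemma proj_diff_fixed:
  fixes x :: "'h::chilbert_space"
  assumes "closed_csubspace M" "v \<in> M"
  shows "proj M (x - v) = proj M x - v"
proof (rule proj_eqI[OF assms(1)])
  show "proj M x - v \<in> M"
    using assms proj_in[OF assms(1)] by (auto simp: closed_csubspace_def intro: subspace_diff)
  show "rinner (x - v - (proj M x - v)) z = 0" if "z \<in> M" for z
    using proj_orthogonal[OF assms(1) that, of x] by simp
qed

lemma proj_pythagoras:
  fixes x :: "'h::chilbert_space"
  assumes "closed_csubspace M"
  shows "(norm x)\<^sup>2 = (norm (proj M x))\<^sup>2 + (norm (proj M x - x))\<^sup>2"
  using norm_sq_add[of "x - proj M x" "proj M x"]
    proj_orthogonal[OF assms proj_in[OF assms], of x x]
  by (simp add: norm_minus_commute)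

lemma closed_csubspace_common_part:
  assumes "\<forall>i\<in>{1..n}. closed_csubspace (H i)"
  shows "closed_csubspace (common_part n H)"
  using assms unfolding closed_csubspace_def common_part_def
  by (auto intro: subspace_Inter closed_INT simp: subspace_def)

section \<open>Partial products of the projections\<close>

lemma proj_prod_diff_common:
  fixes H :: "nat \<Rightarrow> 'h::chilbert_space set"
  assumes "\<forall>i\<in>{1..n}. closed_csubspace (H i)" "v \<in> common_part n H" "k \<le> n"
  shows "proj_prod H k (x - v) = proj_prod H k x - v"
  using assms(3)
proof (induction k)
  case (Suc k)
  have "closed_csubspace (H (Suc k))" "v \<in> H (Suc k)"
    using assms Suc.prems by (auto simp: common_part_def)
  then show ?case using Suc by (simp add: proj_diff_fixed)
qed simp

lemma proj_prod_orthogonal_common: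
  fixes H :: "nat \<Rightarrow> 'h::chilbert_space set"
  assumes "\<forall>i\<in>{1..n}. closed_csubspace (H i)"
    and "\<And>v. v \<in> common_part n H \<Longrightarrow> rinner z v = 0"
    and "k \<le> n" "v \<in> common_part n H"
  shows "rinner (proj_prod H k z) v = 0"
  using assms(3)
proof (induction k)
  case 0
  then show ?case using assms(2,4) by simp
next
  case (Suc k)
  let ?y = "proj_prod H k z"
  have "closed_csubspace (H (Suc k))" "v \<in> H (Suc k)"
    using assms Suc.prems by (auto simp: common_part_def)
  then have "rinner (?y - proj (H (Suc k)) ?y) v = 0" by (rule proj_orthogonal)
  then show ?case using Suc by (simp add: rinner_diff_left)
qed

text \<open>
  The trajectory of \<open>z \<perp> H\<^sub>0\<close> competes in the supremum that defines the Friedrichs number: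
  each projection fixes \<open>H\<^sub>0\<close> pointwise and so also preserves its orthogonal complement.
\<close>
lemma proj_prod_in_orth_diff:
  fixes H :: "nat \<Rightarrow> 'h::chilbert_space set"
  assumes "\<forall>i\<in>{1..n}. closed_csubspace (H i)"
    and "\<And>v. v \<in> common_part n H \<Longrightarrow> rinner z v = 0" and "i \<in> {1..n}"
  shows "proj_prod H i z \<in> H i \<ominus> common_part n H"
proof -
  obtain k where k: "i = Suc k" using assms(3) by (cases i) auto
  have "proj_prod H i z \<in> H i" unfolding k using assms k by (auto intro!: proj_in)
  moreover have "cinner (proj_prod H i z) v = 0" if "v \<in> common_part n H" for v
    using proj_prod_orthogonal_common[OF assms(1,2), of i] assms(3) that
      closed_csubspace_common_part[OF assms(1)]
    by (intro rinner_zero_imp_cinner_zero[of "common_part n H"]) (auto simp: closed_csubspace_def)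
  ultimately show ?thesis by (simp add: orth_diff_def)
qed

section \<open>The Friedrichs number as a bound on the variance\<close>

lemma norm_sq_sum:
  fixes x :: "nat \<Rightarrow> 'h::complex_inner"
  shows "(norm (\<Sum>i=1..n. x i))\<^sup>2
    = (\<Sum>i=1..n. (norm (x i))\<^sup>2) + 2 * (\<Sum>j=1..n. \<Sum>i=1..<j. Re (cinner (x i) (x j)))"
proof (induction n)
  case (Suc n)
  then show ?case
    by (simp add: norm_sq_add rinner_sum_left atLeastLessThanSuc_atLeastAtMost flip: rinner_def)
qed simp

lemma variance_identity:
  fixes x :: "nat \<Rightarrow> 'h::complex_inner"
  assumes "n > 0" and "m = (1 / real n) *\<^sub>R (\<Sum>i=1..n. x i)"
  shows "real n * (\<Sum>i=1..n. (norm (x i - m))\<^sup>2)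
    = real n * (\<Sum>i=1..n. (norm (x i))\<^sup>2) - (norm (\<Sum>i=1..n. x i))\<^sup>2"
proof -
  let ?S = "\<Sum>i=1..n. x i"
  have "(\<Sum>i=1..n. (norm (x i - m))\<^sup>2)
      = (\<Sum>i=1..n. (norm (x i))\<^sup>2) - 2 * rinner ?S m + real n * (norm m)\<^sup>2"
    by (simp add: norm_sq_diff sum.distrib sum_subtractf rinner_sum_left sum_distrib_left)
  moreover have "real n * rinner ?S m = (norm ?S)\<^sup>2"
    using assms(1) by (simp add: assms(2) rinner_scaleR_right rinner_self)
  moreover have "real n * (real n * (norm m)\<^sup>2) = (norm ?S)\<^sup>2"
    using assms(1) by (simp add: assms(2) power_divide power2_eq_square)
  ultimately show ?thesis
    by (simp only: right_diff_distrib distrib_left mult.left_commute[of _ 2])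
qed

text \<open>
  This amounts to unfolding the supremum, once the set of quotients is known to be bounded. The
  bound \<open>1\<close> for the quotients expresses that the variance of a family of vectors is nonnegative.
\<close>
lemma friedrichs_inequality:
  fixes H :: "nat \<Rightarrow> 'h::complex_inner set"
  assumes "n \<ge> 2" "friedrichs_number n H \<le> c"
    and x: "\<forall>i\<in>{1..n}. x i \<in> H i \<ominus> common_part n H"
  shows "2 * (\<Sum>j=1..n. \<Sum>i=1..<j. Re (cinner (x i) (x j)))
    \<le> c * (real n - 1) * (\<Sum>i=1..n. (norm (x i))\<^sup>2)"
proof (cases "\<exists>i\<in>{1..n}. x i \<noteq> 0")
  case False
  then show ?thesis
    by (simp add: norm_sq_sum[of x n, symmetric] flip: rinner_def)
next
  case True
  define q where "q y = 2 / (real n - 1) *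
    ((\<Sum>j=1..n. \<Sum>i=1..<j. Re (cinner (y i) (y j))) / (\<Sum>i=1..n. (norm (y i))\<^sup>2))"
    for y :: "nat \<Rightarrow> 'h"
  have pos: "(\<Sum>i=1..n. (norm (y i))\<^sup>2) > 0" if "\<exists>i\<in>{1..n}. y i \<noteq> 0" for y :: "nat \<Rightarrow> 'h"
    using that by (auto intro!: sum_pos2)
  (* An unbounded set would have an unspecified supremum that says nothing about x. *)
  have q_le: "q y \<le> 1" if "\<exists>i\<in>{1..n}. y i \<noteq> 0" for y
  proof -
    have "0 \<le> real n * (\<Sum>i=1..n. (norm (y i - (1 / real n) *\<^sub>R (\<Sum>i=1..n. y i)))\<^sup>2)"
      by (simp add: sum_nonneg)
    then have "2 * (\<Sum>j=1..n. \<Sum>i=1..<j. Re (cinner (y i) (y j)))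
        \<le> (real n - 1) * (\<Sum>i=1..n. (norm (y i))\<^sup>2)"
      using variance_identity[of n _ y] norm_sq_sum[of y n] assms(1) by (simp add: algebra_simps)
    then show ?thesis using pos[OF that] assms(1) by (simp add: q_def field_simps)
  qed
  have "bdd_above (friedrichs_quotients n H)"
    unfolding friedrichs_quotients_def q_def[symmetric] using q_le by (intro bdd_aboveI[of _ 1]) auto
  moreover have mem: "q x \<in> friedrichs_quotients n H"
    unfolding friedrichs_quotients_def q_def[symmetric] using x True by blast
  ultimately have "q x \<le> Sup (friedrichs_quotients n H)" by (intro cSup_upper)
  then have "q x \<le> c" using assms(2) mem by (auto simp: friedrichs_number_def split: if_splits)
  then show ?thesis using pos[OF True] assms(1) by (simp add: q_def field_simps)
qed

section \<open>The spectral gap of a path\<close>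

text \<open>
  The smallest eigenvalue of the Dirichlet Laplacian on a path, found from its positive
  eigenvector \<open>\<phi> k = sin (k\<pi>/n)\<close> by Jacobi's method. Estimating the mixed term
  of \<open>\<parallel>w (k+1) - w k\<parallel>\<^sup>2\<close> with the weight \<open>\<phi> (k+1) / \<phi> k\<close> loses nothing when \<open>w\<close> is a multiple
  of \<open>\<phi>\<close>, and by the eigenvalue equation for \<open>\<phi>\<close> the resulting coefficients differ from the
  eigenvalue by a telescoping sum.
\<close>
lemma dirichlet_inequality:
  fixes w :: "nat \<Rightarrow> 'h::complex_inner"
  assumes "n > 0" "w 0 = 0" "w n = 0"
  shows "(2 - 2 * cos (pi / real n)) * (\<Sum>k<n. (norm (w k))\<^sup>2)
    \<le> (\<Sum>k<n. (norm (w (Suc k) - w k))\<^sup>2)"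
proof -
  define \<phi> where "\<phi> k = sin (real k * (pi / real n))" for k
  define \<mu> where "\<mu> = 2 - 2 * cos (pi / real n)"
  define t where "t k = (1 - \<phi> (k - 1) / \<phi> k) * (norm (w k))\<^sup>2" for k
  have pos: "\<phi> k > 0" if "0 < k" "k < n" for k
    unfolding \<phi>_def using that by (intro sin_gt_zero) (auto simp: field_simps)
  have \<phi>0: "\<phi> 0 = 0" and \<phi>n: "\<phi> n = 0" using assms(1) by (simp_all add: \<phi>_def)
  have rec: "\<phi> (Suc k) + \<phi> (k - 1) = (2 - \<mu>) * \<phi> k" if "0 < k" for k
  proof -
    obtain j where j: "k = Suc j" using \<open>0 < k\<close> gr0_implies_Suc by blast
    have a: "real (Suc k) * (pi / real n) = real k * (pi / real n) + pi / real n"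
      "real (k - 1) * (pi / real n) = real k * (pi / real n) - pi / real n"
      by (simp_all add: j algebra_simps add_divide_distrib)
    show ?thesis unfolding \<phi>_def \<mu>_def a by (simp add: sin_add sin_diff)
  qed
  (* The terms of t telescope away. At the two ends phi vanishes and the quotients are not
     available, but there one of the two values of w is zero and the step is an equation. *)
  have step: "\<mu> * (norm (w k))\<^sup>2 + t (Suc k) - t k \<le> (norm (w (Suc k) - w k))\<^sup>2"
    if "k < n" for k
  proof (cases "k = 0")
    case True
    then show ?thesis using assms(2) \<phi>0 by (simp add: t_def)
  next
    case False
    then have k: "0 < k" by simp
    have p: "\<phi> k > 0" using pos k that by blast
    have coeff: "\<mu> - (1 - \<phi> (k - 1) / \<phi> k) = 1 - \<phi> (Suc k) / \<phi> k"
      using rec[OF k] p by (simp add: field_simps)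
    have "\<mu> * (norm (w k))\<^sup>2 + t (Suc k) - t k
        = (\<mu> - (1 - \<phi> (k - 1) / \<phi> k)) * (norm (w k))\<^sup>2 + t (Suc k)"
      unfolding t_def by (simp add: algebra_simps)
    also have "\<dots> = (1 - \<phi> (Suc k) / \<phi> k) * (norm (w k))\<^sup>2
        + (1 - \<phi> k / \<phi> (Suc k)) * (norm (w (Suc k)))\<^sup>2"
      unfolding coeff by (simp add: t_def)
    also have "\<dots> \<le> (norm (w (Suc k) - w k))\<^sup>2"
    proof (cases "Suc k = n")
      case True
      then show ?thesis using \<phi>n assms(3) by simp
    next
      case False
      then have "\<phi> (Suc k) > 0" using pos that by simp
      then have "2 * rinner (w k) (w (Suc k))
          \<le> \<phi> (Suc k) / \<phi> k * (norm (w k))\<^sup>2 + \<phi> k / \<phi> (Suc k) * (norm (w (Suc k)))\<^sup>2"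
        using two_rinner_le[of "\<phi> (Suc k) / \<phi> k" "w k" "w (Suc k)"] p by (simp add: mult.commute)
      then show ?thesis
        by (simp add: norm_sq_diff rinner_commute[of "w (Suc k)"] algebra_simps)
    qed
    finally show ?thesis .
  qed
  have "\<mu> * (\<Sum>k<n. (norm (w k))\<^sup>2) = (\<Sum>k<n. \<mu> * (norm (w k))\<^sup>2 + t (Suc k) - t k)"
    using sum_lessThan_telescope[of t n] assms(2,3)
    by (simp add: t_def sum.distrib sum_distrib_left add_diff_eq[symmetric])
  also have "\<dots> \<le> (\<Sum>k<n. (norm (w (Suc k) - w k))\<^sup>2)"
    using step by (intro sum_mono) simp
  finally show ?thesis unfolding \<mu>_def .
qed

text \<open>
  The difference operator and the partial sum operator are negative adjoints of each other up to
  a boundary term, which vanishes for \<open>u\<close> with total sum zero.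
\<close>
lemma summation_by_parts:
  fixes u :: "nat \<Rightarrow> 'h::complex_inner"
  assumes "m > 0"
  defines "w \<equiv> \<lambda>k. \<Sum>i=1..k. u i"
  shows "(\<Sum>i=1..m. (norm (u i))\<^sup>2)
    = rinner (u m) (w m) - (\<Sum>k=1..<m. rinner (u (Suc k) - u k) (w k))"
  using assms(1)
proof (induction m rule: nat_induct_non_zero)
  case 1
  then show ?case by (simp add: w_def rinner_self)
next
  case (Suc m)
  have "w (Suc m) = w m + u (Suc m)" by (simp add: w_def)
  then show ?case using Suc
    by (simp add: rinner_bilinear rinner_self)
qed

text \<open>
  The Neumann Laplacian on \<open>n\<close> vertices has the same spectral gap as the Dirichlet Laplacian on
  the edges. The partial sums \<open>w\<close> of \<open>u\<close> satisfy the Dirichlet conditions \<open>w 0 = w n = 0\<close>, and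
  \<open>u\<close> is their difference sequence, so \<open>dirichlet_inequality\<close> bounds \<open>w\<close> by \<open>u\<close>. Summation by
  parts writes \<open>\<Sum> \<parallel>u i\<parallel>\<^sup>2\<close> as an inner product of the differences of \<open>u\<close> with \<open>w\<close>; Young's
  inequality then absorbs half of it.
\<close>
lemma discrete_wirtinger:
  fixes u :: "nat \<Rightarrow> 'h::complex_inner"
  assumes "n > 0" "(\<Sum>i=1..n. u i) = 0"
  shows "(2 - 2 * cos (pi / real n)) * (\<Sum>i=1..n. (norm (u i))\<^sup>2)
    \<le> (\<Sum>k=1..<n. (norm (u (Suc k) - u k))\<^sup>2)"
proof -
  define \<mu> where "\<mu> = 2 - 2 * cos (pi / real n)"
  define w where "w k = (\<Sum>i=1..k. u i)" for k
  let ?U = "\<Sum>i=1..n. (norm (u i))\<^sup>2" and ?D = "\<Sum>k=1..<n. (norm (u (Suc k) - u k))\<^sup>2"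
  have \<mu>: "\<mu> \<ge> 0" by (simp add: \<mu>_def)
  have w0: "w 0 = 0" and wn: "w n = 0" using assms(2) by (simp_all add: w_def)
  have "w (Suc k) - w k = u (Suc k)" for k by (simp add: w_def)
  then have diff: "(\<Sum>k<n. (norm (w (Suc k) - w k))\<^sup>2) = ?U"
    by (simp add: sum.atLeast1_atMost_eq)
  have "{..<n} = insert 0 {1..<n}" using assms(1) by auto
  then have "(\<Sum>k<n. (norm (w k))\<^sup>2) = (\<Sum>k=1..<n. (norm (w k))\<^sup>2)"
    using w0 by simp
  then have W: "\<mu> * (\<Sum>k=1..<n. (norm (w k))\<^sup>2) \<le> ?U"
    using dirichlet_inequality[of n w] assms(1) w0 wn diff by (simp add: \<mu>_def)
  have U: "?U = (\<Sum>k=1..<n. - rinner (u (Suc k) - u k) (w k))"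
    using summation_by_parts[of n u] assms(1) wn by (simp add: w_def sum_negf)
  have young: "2 * \<mu> * - rinner d v \<le> (norm d)\<^sup>2 + \<mu>\<^sup>2 * (norm v)\<^sup>2" for d v :: 'h
    using two_rinner_le[of 1 d "- (\<mu> *\<^sub>R v)"]
    by (simp add: rinner_minus_right rinner_scaleR_right power_mult_distrib)
  have "2 * \<mu> * ?U \<le> (\<Sum>k=1..<n. (norm (u (Suc k) - u k))\<^sup>2 + \<mu>\<^sup>2 * (norm (w k))\<^sup>2)"
    unfolding U sum_distrib_left by (intro sum_mono young)
  also have "\<dots> = ?D + \<mu> * (\<mu> * (\<Sum>k=1..<n. (norm (w k))\<^sup>2))"
    by (simp add: sum.distrib sum_distrib_left power2_eq_square mult.assoc)
  also have "\<dots> \<le> ?D + \<mu> * ?U" using W \<mu> by (intro add_left_mono mult_left_mono)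
  finally show ?thesis unfolding \<mu>_def[symmetric] by linarith
qed

section \<open>The bound for the product of projections\<close>

text \<open>
  The comparison is with \<open>P\<^sub>1 z\<close> rather than with \<open>z\<close>, because \<open>z\<close> need not belong to any of the
  subspaces: only \<open>x\<^sub>1, \<dots>, x\<^sub>n\<close> can be inserted into the Friedrichs quotient.
\<close>
lemma norm_proj_prod_sq_bound:
  fixes H :: "nat \<Rightarrow> 'h::chilbert_space set" and z :: 'h
  assumes n: "n \<ge> 2" and c: "c \<le> 1"
    and H: "\<forall>i\<in>{1..n}. closed_csubspace (H i)" and F: "friedrichs_number n H \<le> c"
    and z: "\<And>v. v \<in> common_part n H \<Longrightarrow> rinner z v = 0"
  defines "g \<equiv> 4 * (real n - 1) * (sin (pi / (2 * real n)))\<^sup>2 * (1 - c)"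
  shows "(real n + (real n - 1) * g) * (norm (proj_prod H n z))\<^sup>2
    \<le> (real n - g) * (norm (proj_prod H 1 z))\<^sup>2"
proof -
  define x where "x k = proj_prod H k z" for k
  define m where "m = (1 / real n) *\<^sub>R (\<Sum>i=1..n. x i)"
  define \<mu> where "\<mu> = 2 - 2 * cos (pi / real n)"
  define S where "S = (\<Sum>i=1..n. (norm (x i))\<^sup>2)"
  have "cos (pi / real n) = cos (2 * (pi / (2 * real n)))" by simp
  then have \<mu>_sin: "\<mu> = 4 * (sin (pi / (2 * real n)))\<^sup>2"
    unfolding \<mu>_def cos_double_sin by simp
  have g: "g = \<mu> * ((real n - 1) * (1 - c))" by (simp add: g_def \<mu>_sin)
  have \<mu>: "\<mu> \<ge> 0" by (simp add: \<mu>_def)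
  have g0: "g \<ge> 0" using \<mu> n c by (simp add: g)
  have pyth: "(norm (x (Suc k) - x k))\<^sup>2 = (norm (x k))\<^sup>2 - (norm (x (Suc k)))\<^sup>2" if "k < n" for k
    using proj_pythagoras[of "H (Suc k)" "x k"] H that by (simp add: x_def)
  have mono: "(norm (x n))\<^sup>2 \<le> (norm (x k))\<^sup>2" if "k \<le> n" for k
    using that
  proof (induction k rule: inc_induct)
    case (step k)
    have "0 \<le> (norm (x (Suc k) - x k))\<^sup>2" by simp
    then show ?case using step pyth[of k] by linarith
  qed simp
  have "2 * (\<Sum>j=1..n. \<Sum>i=1..<j. Re (cinner (x i) (x j))) \<le> c * (real n - 1) * S"
    unfolding S_def x_def using proj_prod_in_orth_diff[OF H z]
    by (intro friedrichs_inequality[OF n F]) auto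
  then have "(real n - 1) * (1 - c) * S \<le> real n * S - (norm (\<Sum>i=1..n. x i))\<^sup>2"
    using norm_sq_sum[of x n] by (simp add: S_def algebra_simps)
  also have "\<dots> = real n * (\<Sum>i=1..n. (norm (x i - m))\<^sup>2)"
    using variance_identity[of n m x] n by (simp add: m_def S_def)
  finally have variance: "(real n - 1) * (1 - c) * S \<le> real n * (\<Sum>i=1..n. (norm (x i - m))\<^sup>2)" .
  have "(\<Sum>i=1..n. x i - m) = 0"
    using n by (simp add: m_def sum_subtractf sum_constant_scaleR)
  then have "\<mu> * (\<Sum>i=1..n. (norm (x i - m))\<^sup>2) \<le> (\<Sum>k=1..<n. (norm (x (Suc k) - x k))\<^sup>2)"
    using discrete_wirtinger[of n "\<lambda>i. x i - m"] n by (simp add: \<mu>_def)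
  also have "\<dots> = (\<Sum>k=1..<n. (norm (x k))\<^sup>2 - (norm (x (Suc k)))\<^sup>2)"
    using pyth by (intro sum.cong) auto
  also have "\<dots> = (norm (x 1))\<^sup>2 - (norm (x n))\<^sup>2"
    using sum_Suc_diff'[of 1 n "\<lambda>k. - (norm (x k))\<^sup>2"] n by simp
  finally have "real n * (\<mu> * (\<Sum>i=1..n. (norm (x i - m))\<^sup>2))
      \<le> real n * ((norm (x 1))\<^sup>2 - (norm (x n))\<^sup>2)"
    by (rule mult_left_mono) simp
  with mult_left_mono[OF variance \<mu>] have A: "g * S \<le> real n * ((norm (x 1))\<^sup>2 - (norm (x n))\<^sup>2)"
    unfolding g by (simp only: mult.assoc mult.left_commute[of \<mu>])
  have "{1..n} = insert 1 {2..n}" using n by auto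
  then have "S = (norm (x 1))\<^sup>2 + (\<Sum>i=2..n. (norm (x i))\<^sup>2)" by (simp add: S_def)
  moreover have "(real n - 1) * (norm (x n))\<^sup>2 \<le> (\<Sum>i=2..n. (norm (x i))\<^sup>2)"
    using sum_mono[of "{2..n}" "\<lambda>_. (norm (x n))\<^sup>2" "\<lambda>i. (norm (x i))\<^sup>2"] mono n
    by (simp add: of_nat_diff algebra_simps)
  ultimately have "g * ((norm (x 1))\<^sup>2 + (real n - 1) * (norm (x n))\<^sup>2) \<le> g * S"
    using g0 by (intro mult_left_mono) auto
  with A show ?thesis by (simp add: x_def algebra_simps)
qed

text \<open>
  This makes the numerator of the bound nonnegative. From \<open>n = 3\<close> on, \<open>sin (\<pi>/(2n)) \<le> 1/2\<close>
  suffices; for \<open>n = 2\<close> both sides are equal.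
\<close>
lemma four_sin_sq_le:
  fixes n :: nat
  assumes "n \<ge> 2"
  shows "4 * (real n - 1) * (sin (pi / (2 * real n)))\<^sup>2 \<le> real n"
proof (cases "n = 2")
  case True
  then show ?thesis by (simp add: sin_45 power_divide)
next
  case False
  have "sin (pi / (2 * real n)) \<le> sin (pi / 6)"
  proof (rule sin_monotone_2pi_le)
    show "pi / (2 * real n) \<le> pi / 6"
      using assms False by (intro divide_left_mono) auto
    have "0 \<le> pi / (2 * real n)" by simp
    then show "- (pi / 2) \<le> pi / (2 * real n)" using pi_ge_zero by linarith
  qed simp
  moreover have "0 \<le> sin (pi / (2 * real n))"
    using assms by (intro sin_ge_zero) (auto simp: field_simps)
  ultimately have "(sin (pi / (2 * real n)))\<^sup>2 \<le> (1 / 2)\<^sup>2"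
    unfolding sin_30 by (intro power_mono)
  then have "(real n - 1) * (4 * (sin (pi / (2 * real n)))\<^sup>2) \<le> (real n - 1) * 1"
    using assms by (intro mult_left_mono) (auto simp: power2_eq_square)
  then show ?thesis by (simp add: algebra_simps)
qed

lemma onorm_proj_prod_le:
  fixes H :: "nat \<Rightarrow> 'h::chilbert_space set"
  assumes n: "n \<ge> 2" and c: "0 \<le> c" "c \<le> 1"
    and H: "\<forall>i\<in>{1..n}. closed_csubspace (H i)" and F: "friedrichs_number n H \<le> c"
  shows "onorm (\<lambda>x. proj_prod H n x - proj (common_part n H) x)
    \<le> sqrt ((real n - 4 * (real n - 1) * (sin (pi / (2 * real n)))\<^sup>2 * (1 - c))
          / (real n + 4 * (real n - 1)\<^sup>2 * (sin (pi / (2 * real n)))\<^sup>2 * (1 - c)))"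
proof -
  let ?M = "common_part n H"
  define g where "g = 4 * (real n - 1) * (sin (pi / (2 * real n)))\<^sup>2 * (1 - c)"
  define q where "q = (real n - g) / (real n + (real n - 1) * g)"
  have M: "closed_csubspace ?M" by (rule closed_csubspace_common_part[OF H])
  have g0: "g \<ge> 0" using n c by (simp add: g_def)
  have gn: "g \<le> real n"
    unfolding g_def
    by (rule order_trans[OF mult_left_le four_sin_sq_le[OF n]]) (use n c in auto)
  have den: "real n + (real n - 1) * g > 0" using n g0 by (intro add_pos_nonneg) auto
  have q0: "q \<ge> 0" using gn den by (simp add: q_def)
  have "norm (proj_prod H n x - proj ?M x) \<le> sqrt q * norm x" for x
  proof -
    define z where "z = x - proj ?M x"
    have z: "rinner z v = 0" if "v \<in> ?M" for v
      unfolding z_def using proj_orthogonal[OF M that] .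
    have red: "proj_prod H n x - proj ?M x = proj_prod H n z"
      unfolding z_def using proj_prod_diff_common[OF H proj_in[OF M]] by simp
    have "(norm (proj_prod H 1 z))\<^sup>2 \<le> (norm z)\<^sup>2"
      using proj_pythagoras[of "H 1" z] H n by simp
    also have "\<dots> \<le> (norm x)\<^sup>2"
      using proj_pythagoras[OF M, of x] by (simp add: z_def norm_minus_commute)
    finally have "(real n - g) * (norm (proj_prod H 1 z))\<^sup>2 \<le> (real n - g) * (norm x)\<^sup>2"
      using gn by (intro mult_left_mono) auto
    moreover have "(real n + (real n - 1) * g) * (norm (proj_prod H n z))\<^sup>2
        \<le> (real n - g) * (norm (proj_prod H 1 z))\<^sup>2"
      unfolding g_def by (rule norm_proj_prod_sq_bound[OF n c(2) H F z])
    ultimately have "(norm (proj_prod H n z))\<^sup>2 \<le> q * (norm x)\<^sup>2"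
      using den by (simp add: q_def field_simps)
    then have "norm (proj_prod H n z) \<le> sqrt (q * (norm x)\<^sup>2)" by (rule real_le_rsqrt)
    then show ?thesis by (simp add: red real_sqrt_mult)
  qed
  then have "onorm (\<lambda>x. proj_prod H n x - proj ?M x) \<le> sqrt q"
    using q0 by (intro onorm_bound) auto
  moreover have "(real n - 1) * g = 4 * (real n - 1)\<^sup>2 * (sin (pi / (2 * real n)))\<^sup>2 * (1 - c)"
    by (simp add: g_def power2_eq_square)
  ultimately show ?thesis by (simp only: q_def) (simp only: g_def)
qed

text \<open>
  A system over which the supremum \<open>sup_proj_norm\<close> is taken, so that it is a supremum of a
  nonempty set.
\<close>
lemma friedrichs_number_const_UNIV:
  assumes "n \<ge> 1"
  shows "friedrichs_number n (\<lambda>_. UNIV :: 'h::complex_inner set) = 0"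
proof -
  have "common_part n (\<lambda>_. UNIV :: 'h set) = UNIV" by (simp add: common_part_def)
  moreover have "x = 0" if "\<forall>y. cinner x y = 0" for x :: 'h
    using that rinner_self[of x] by (simp add: rinner_def)
  ultimately show ?thesis
    by (auto simp: friedrichs_number_def friedrichs_quotients_def orth_diff_def)
qed

theorem theorem2p6:
  fixes n :: nat and c :: real
  assumes "n \<ge> 2" and "0 \<le> c" and "c \<le> 1"
  shows "sup_proj_norm TYPE('h::chilbert_space) n c
    \<le> sqrt ((real n - 4 * (real n - 1) * (sin (pi / (2 * real n)))\<^sup>2 * (1 - c))
          / (real n + 4 * (real n - 1)\<^sup>2 * (sin (pi / (2 * real n)))\<^sup>2 * (1 - c)))"
  unfolding sup_proj_norm_def
proof (rule cSup_least)
  have "friedrichs_number n (\<lambda>_. UNIV :: 'h set) \<le> c"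
    using friedrichs_number_const_UNIV[of n, where 'h = 'h] assms by simp
  moreover have "closed_csubspace (UNIV :: 'h set)" by (simp add: closed_csubspace_def)
  ultimately show "{onorm (\<lambda>x. proj_prod H n x - proj (common_part n H) x) | H :: nat \<Rightarrow> 'h set.
      (\<forall>i\<in>{1..n}. closed_csubspace (H i)) \<and> friedrichs_number n H \<le> c} \<noteq> {}"
    by (simp only: Collect_empty_eq) (auto intro!: exI[of _ "\<lambda>_. UNIV"])
next
  fix a
  assume "a \<in> {onorm (\<lambda>x. proj_prod H n x - proj (common_part n H) x) | H :: nat \<Rightarrow> 'h set.
      (\<forall>i\<in>{1..n}. closed_csubspace (H i)) \<and> friedrichs_number n H \<le> c}"
  then obtain H :: "nat \<Rightarrow> 'h set" where
    "a = onorm (\<lambda>x. proj_prod H n x - proj (common_part n H) x)"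
    "\<forall>i\<in>{1..n}. closed_csubspace (H i)" "friedrichs_number n H \<le> c"
    by (elim CollectE exE conjE)
  then show "a \<le> sqrt ((real n - 4 * (real n - 1) * (sin (pi / (2 * real n)))\<^sup>2 * (1 - c))
      / (real n + 4 * (real n - 1)\<^sup>2 * (sin (pi / (2 * real n)))\<^sup>2 * (1 - c)))"
    using onorm_proj_prod_le[OF assms] by simp
qed

end
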